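(* Let $A$ be an $m\times n$ matrix over a commutative ring with unity, $m\le n$, write $R(x;z;A)=\sum_{l=0}^m r_l(z;A)x^l$ with $r_0(z;A)=1$, and for $k\ge1$ let $(z)^{(k)}=\prod_{i=0}^{k-1}(z+i)$, $(z)^{(0)}=1$. Then for $0\le l\le m$, $$r_l(z;yJ_{m,n}-A)=\sum_{s=0}^l(-1)^s\binom{m-s}{l-s}r_s(z;A)\,(n-l+z)^{(l-s)}y^{l-s}.$$ In particular, $$\mathrm{per}(z;yJ_{m,n}-A)=\sum_{s=0}^m(-1)^s r_s(z;A)\,(n-m+z)^{(m-s)}y^{m-s}.$$
   Context: $N_n=\{1,\dots,n\}$; $J_{m,n}$ is the $m\times n$ all-ones matrix. For $S\subseteq N_n$, $\mathrm{Inj}(S,N_n)$ is the set of injective maps $S\to N_n$; for $\varphi\in\mathrm{Inj}(S,N_n)$, $|\varphi|$ is the number of cycles of $\varphi$, i.e. the number of nonempty sets $C\subseteq S$ of the form $\{j,\varphi(j),\dots,\varphi^{p-1}(j)\}$ with $\varphi^p(j)=j$. For an $m\times n$ matrix $B=(b_{i,j})$, $m\le n$: $r_l(z;B)=\sum_{S\subseteq N_m,|S|=l}\sum_{\varphi\in\mathrm{Inj}(S,N_n)}z^{|\varphi|}\prod_{i\in S}b_{i,\varphi(i)}$, $R(x;z;B)=\sum_l r_l(z;B)x^l$ (cyclic rook polynomial), and $\mathrm{per}(z;B)=r_m(z;B)$ (cyclic permanent). Here $y,z$ are indeterminates (or ring elements). *)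

theory Defs
  imports "HOL-Computational_Algebra.Polynomial" "Jordan_Normal_Form.Matrix" "HOL-Library.FuncSet"
begin

text \<open>
  Rows and columns are indexed from 0, as usual for \<^typ>\<open>'a mat\<close>: the index set
  \<open>{1,\<dots>,n}\<close> is rendered as \<^term>\<open>{..<n::nat}\<close>.
\<close>

definition inj_maps :: "nat set \<Rightarrow> nat set \<Rightarrow> (nat \<Rightarrow> nat) set" where
  "inj_maps S T = {\<phi> \<in> S \<rightarrow>\<^sub>E T. inj_on \<phi> S}"

text \<open>
  Every orbit point \<open>(\<phi> ^^ i) j\<close> with \<open>i < p\<close> is required to lie in \<open>S\<close>, so the values of
  \<open>\<phi>\<close> outside \<open>S\<close> are irrelevant. The number \<open>p\<close> need not be the
  minimal period, since multiples of it give the same set.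
\<close>

definition cycles :: "nat set \<Rightarrow> (nat \<Rightarrow> nat) \<Rightarrow> nat set set" where
  "cycles S \<phi> = {C. C \<noteq> {} \<and> C \<subseteq> S \<and>
     (\<exists>j p. C = {(\<phi> ^^ i) j | i. i < p} \<and> (\<phi> ^^ p) j = j)}"

definition cyclic_rook_number :: "nat \<Rightarrow> 'a::comm_ring_1 \<Rightarrow> 'a mat \<Rightarrow> 'a" where
  "cyclic_rook_number l z B =
     (\<Sum>S | S \<subseteq> {..<dim_row B} \<and> card S = l.
        \<Sum>\<phi>\<in>inj_maps S {..<dim_col B}. z ^ card (cycles S \<phi>) * (\<Prod>i\<in>S. B $$ (i, \<phi> i)))"

definition cyclic_rook_poly :: "'a::comm_ring_1 \<Rightarrow> 'a mat \<Rightarrow> 'a poly" where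
  "cyclic_rook_poly z B = (\<Sum>l\<le>dim_row B. monom (cyclic_rook_number l z B) l)"

definition cyclic_permanent :: "'a::comm_ring_1 \<Rightarrow> 'a mat \<Rightarrow> 'a" where
  "cyclic_permanent z B = cyclic_rook_number (dim_row B) z B"

definition all_ones_mat :: "nat \<Rightarrow> nat \<Rightarrow> 'a::comm_ring_1 mat" where
  "all_ones_mat m n = mat m n (\<lambda>_. 1)"

lemma cyclic_rook_number_0: "cyclic_rook_number 0 z B = 1"
proof -
  have "{S. S \<subseteq> {..<dim_row B} \<and> card S = 0} = {{}}"
    by (auto dest: finite_subset[OF _ finite_lessThan])
  moreover have "inj_maps {} {..<dim_col B} = {\<lambda>_. undefined}"
    by (auto simp: inj_maps_def)
  moreover have "cycles {} \<phi> = {}" for \<phi>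
    by (auto simp: cycles_def)
  ultimately show ?thesis
    by (simp add: cyclic_rook_number_def)
qed

lemma coeff_cyclic_rook_poly:
  "l \<le> dim_row B \<Longrightarrow> coeff (cyclic_rook_poly z B) l = cyclic_rook_number l z B"
  by (simp add: cyclic_rook_poly_def coeff_sum)

end

theory Submission
  imports Defs
begin

text \<open>
  Expand \<open>\<Prod>i\<in>S. (y - a\<^sub>i)\<close> over subsets \<open>T\<close> of \<open>S\<close>; the weight of \<open>T\<close> is then a sum of
  \<open>z ^ |\<phi>|\<close> over the extensions \<open>\<phi>\<close> to \<open>S\<close> of the injections \<open>\<psi>\<close> on \<open>T\<close>. When an injection
  on \<open>t\<close> points is extended by one point \<open>j\<close>, there are \<open>n - t\<close> admissible values, and exactly one
  of them, the start of the path ending in \<open>j\<close>, closes a new cycle. Hence each step contributes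
  a factor \<open>n - t - 1 + z\<close>, and these factors multiply to the rising factorial.
\<close>

section \<open>Cycles through a given point\<close>

text \<open>Iterates up to index \<open>p\<close> only evaluate the map at points of index below
  \<open>p\<close>. Hence agreement on \<open>S\<close> suffices even when the endpoint
  \<open>i = p\<close> lies outside \<open>S\<close>, as it does for paths ending in a new
  point.\<close>

lemma funpow_cong_orbit:
  assumes "\<And>i. i < p \<Longrightarrow> (f ^^ i) x \<in> S" and "\<And>x. x \<in> S \<Longrightarrow> f x = g x" and "i \<le> p"
  shows "(f ^^ i) x = (g ^^ i) x"
  using \<open>i \<le> p\<close>
proof (induction i)
  case (Suc i)
  then show ?case using assms(1)[of i] assms(2) by simp
qed simp

lemma cycles_cong:
  assumes "\<And>x. x \<in> S \<Longrightarrow> f x = g x"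
  shows "cycles S f = cycles S g"
proof -
  have "C \<in> cycles S g" if "C \<in> cycles S f" and fg: "\<And>x. x \<in> S \<Longrightarrow> f x = g x" for C f g
  proof -
    from that(1) obtain j p where C: "C \<noteq> {}" "C \<subseteq> S" "C = {(f ^^ i) j | i. i < p}" "(f ^^ p) j = j"
      unfolding cycles_def by blast
    have inS: "(f ^^ i) j \<in> S" if "i < p" for i using C that by blast
    have eq: "(f ^^ i) j = (g ^^ i) j" if "i \<le> p" for i
      using funpow_cong_orbit[of p f j S g, OF inS fg that] .
    have "C = {(g ^^ i) j | i. i < p}" 
      unfolding C(3) setcompr_eq_image using eq by (intro image_cong) auto
    moreover have "(g ^^ p) j = j" using C(4) eq by simp
    ultimately show ?thesis using C(1,2) unfolding cycles_def by blast
  qed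
  from this[of _ f g] this[of _ g f] assms show ?thesis by auto
qed

text \<open>Serves to identify the cycles in \<open>insert j S\<close> that avoid \<open>j\<close>
  with the cycles in \<open>S\<close>.\<close>

lemma cycles_UNIV: "cycles S f = {C \<in> cycles UNIV f. C \<subseteq> S}"
  unfolding cycles_def mem_Collect_eq
  by (intro Collect_cong iffI; elim conjE; intro conjI; (assumption | rule subset_UNIV))

lemma cycles_subset_Pow: "cycles S f \<subseteq> Pow S"
  by (auto simp: cycles_def)

text \<open>A cycle is the full forward orbit of each of its points, so at most one cycle passes
  through a given point.\<close>

lemma cycle_eq_orbit:
  assumes "C \<in> cycles S f" and "x \<in> C"
  shows "C = range (\<lambda>i. (f ^^ i) x)" and "\<exists>p>0. (f ^^ p) x = x"
proof -
  from assms obtain j p where C: "C = {(f ^^ i) j | i. i < p}" "(f ^^ p) j = j" "p > 0"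
    unfolding cycles_def by fastforce
  obtain a where a: "a < p" "x = (f ^^ a) j" using assms C by blast
  have per: "(f ^^ (i mod p)) j = (f ^^ i) j" for i
    using funpow_mod_eq[OF C(2)] by simp
  have Cj: "C = range (\<lambda>i. (f ^^ i) j)"
  proof
    show "C \<subseteq> range (\<lambda>i. (f ^^ i) j)" using C by auto
    show "range (\<lambda>i. (f ^^ i) j) \<subseteq> C"
    proof
      fix y assume "y \<in> range (\<lambda>i. (f ^^ i) j)"
      then obtain i where "y = (f ^^ i) j" by auto
      then have "y = (f ^^ (i mod p)) j" using per by simp
      then show "y \<in> C" using C by auto
    qed
  qed
  \<comment> \<open>Since \<open>x\<close> lies \<open>a\<close> steps after \<open>j\<close>, the
    remaining \<open>p - a\<close> steps lead back to \<open>j\<close>, so the orbits of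
    \<open>x\<close> and \<open>j\<close> contain each other.\<close>
  have jx: "(f ^^ (p - a)) x = j"
    using a C(2) by (metis funpow_add comp_apply le_add_diff_inverse2 less_imp_le)
  have "(f ^^ i) j = (f ^^ (i + (p - a))) x" for i using jx by (simp add: funpow_add)
  moreover have "(f ^^ i) x = (f ^^ (i + a)) j" for i using a by (simp add: funpow_add)
  ultimately show "C = range (\<lambda>i. (f ^^ i) x)" unfolding Cj by (fastforce simp: image_iff)
  have "(f ^^ p) x = (f ^^ (p + a)) j" using a by (simp add: funpow_add)
  also have "\<dots> = (f ^^ (a + p)) j" by (simp add: add.commute)
  also have "\<dots> = x" using a C by (simp add: funpow_add)
  finally show "\<exists>p>0. (f ^^ p) x = x" using C by blast
qed

text \<open>A path from \<open>v\<close> to \<open>j\<close> in the functional graph of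
  \<open>f\<close>. Only the points before its end must lie in \<open>S\<close>, and
  \<open>p = 0\<close> is allowed; this covers \<open>v = j\<close>, where the extension gets a
  fixed point.\<close>

definition reaches :: "nat set \<Rightarrow> (nat \<Rightarrow> nat) \<Rightarrow> nat \<Rightarrow> nat \<Rightarrow> bool" where
  "reaches S f v j \<longleftrightarrow> (\<exists>p. (f ^^ p) v = j \<and> (\<forall>i<p. (f ^^ i) v \<in> S))"

text \<open>Cycles avoiding \<open>j\<close> do not see the new value. A cycle through
  \<open>j\<close> must continue with \<open>v\<close> and return to \<open>j\<close> along a path
  in \<open>S\<close>, so it exists exactly when \<open>v\<close> reaches \<open>j\<close>, and then
  it is the orbit of \<open>j\<close>.\<close>

lemma cycles_insert:
  assumes "j \<notin> S"
  shows "cycles (insert j S) (f(j := v)) =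
    cycles S f \<union> (if reaches S f v j then {range (\<lambda>i. ((f(j := v)) ^^ i) j)} else {})"
proof -
  let ?g = "f(j := v)" and ?O = "range (\<lambda>i. ((f(j := v)) ^^ i) j)"
  have fg: "f x = ?g x" if "x \<in> S" for x using that assms by auto
  have away: "{C \<in> cycles (insert j S) ?g. j \<notin> C} = cycles S f"
  proof -
    have "{C \<in> cycles (insert j S) ?g. j \<notin> C} = cycles S ?g"
      using assms by (subst (1 2) cycles_UNIV) (auto dest: subset_insert_iff[THEN iffD1])
    then show ?thesis using cycles_cong[of S f ?g, OF fg] by simp
  qed
  have reach: "?O \<in> cycles (insert j S) ?g" if r: "reaches S f v j"
  proof -
    from r obtain p where p: "(f ^^ p) v = j" "\<And>i. i < p \<Longrightarrow> (f ^^ i) v \<in> S"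
      unfolding reaches_def by blast
    have eq: "(f ^^ i) v = (?g ^^ i) v" if "i \<le> p" for i
      using funpow_cong_orbit[of p f v S ?g, OF p(2) fg that] .
    \<comment> \<open>The first step leads from \<open>j\<close> to \<open>v\<close>, so a path of
      length \<open>p\<close> from \<open>v\<close> to \<open>j\<close> closes a cycle with period
      \<open>Suc p\<close>.\<close>
    have step: "(?g ^^ Suc i) j = (?g ^^ i) v" for i by (simp add: funpow_swap1)
    have per: "(?g ^^ Suc p) j = j" using step[of p] eq[of p] p by simp
    let ?C = "{(?g ^^ i) j | i. i < Suc p}"
    have "?C \<subseteq> insert j S"
    proof
      fix x assume "x \<in> ?C"
      then obtain i where i: "i < Suc p" "x = (?g ^^ i) j" by blast
      then show "x \<in> insert j S" using step eq p(2) by (cases i) auto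
    qed
    moreover have jC: "j \<in> ?C" by (auto intro: exI[of _ 0])
    ultimately have "?C \<in> cycles (insert j S) ?g" using per unfolding cycles_def by blast
    then show ?thesis using cycle_eq_orbit(1)[OF _ jC] by simp
  qed
  have through: "C = ?O \<and> reaches S f v j" if C: "C \<in> cycles (insert j S) ?g" "j \<in> C" for C
  proof
    show CO: "C = ?O" using cycle_eq_orbit(1)[OF C] .
    \<comment> \<open>Taking the first return to \<open>j\<close> keeps all intermediate points
      different from \<open>j\<close>. They then lie in \<open>S\<close>, where \<open>?g\<close>
      agrees with \<open>f\<close>.\<close>
    define p where "p = (LEAST p. (?g ^^ Suc p) j = j)"
    obtain q where "q > 0" "(?g ^^ q) j = j" using cycle_eq_orbit(2)[OF C] by blast
    then have "(?g ^^ Suc (q - 1)) j = j" by simp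
    then have p: "(?g ^^ Suc p) j = j" unfolding p_def by (rule LeastI)
    have min: "(?g ^^ Suc i) j \<noteq> j" if "i < p" for i
      using not_less_Least that unfolding p_def by blast
    have step: "(?g ^^ Suc i) j = (?g ^^ i) v" for i by (simp add: funpow_swap1)
    have inS: "(?g ^^ i) v \<in> S" if "i < p" for i
    proof -
      have "(?g ^^ Suc i) j \<in> C" unfolding CO by blast
      then have "(?g ^^ Suc i) j \<in> insert j S" using C(1) unfolding cycles_def by blast
      then show ?thesis using min[OF that] step by simp
    qed
    have eq: "(?g ^^ i) v = (f ^^ i) v" if "i \<le> p" for i
      by (rule funpow_cong_orbit[of p ?g v S f]) (use inS fg that in auto)
    show "reaches S f v j" unfolding reaches_def
      using p step[of p] eq inS by (intro exI[of _ p]) auto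
  qed
  have "cycles (insert j S) ?g = {C \<in> cycles (insert j S) ?g. j \<notin> C} \<union>
      {C \<in> cycles (insert j S) ?g. j \<in> C}" by blast
  also have "{C \<in> cycles (insert j S) ?g. j \<in> C} = (if reaches S f v j then {?O} else {})"
    using reach through by (auto intro: range_eqI[of _ _ 0])
  finally show ?thesis unfolding away .
qed

lemma card_cycles_insert:
  assumes "finite S" and "j \<notin> S"
  shows "card (cycles (insert j S) (f(j := v))) =
    card (cycles S f) + (if reaches S f v j then 1 else 0)"
proof -
  have "j \<in> range (\<lambda>i. ((f(j := v)) ^^ i) j)" by (rule range_eqI[of _ _ 0]) simp
  then have "range (\<lambda>i. ((f(j := v)) ^^ i) j) \<notin> cycles S f"
    using assms(2) by (auto simp: cycles_def)
  moreover have "finite (cycles S f)"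
    using assms(1) finite_subset[OF cycles_subset_Pow] by blast
  ultimately show ?thesis by (simp add: cycles_insert[OF assms(2)])
qed

text \<open>Follow both paths backwards from \<open>j\<close>: injectivity forces the same
  predecessors in \<open>S\<close>. When one path is exhausted, its start has no preimage in
  \<open>S\<close>, so the other path must end there too.\<close>

lemma reaches_unique:
  assumes inj: "inj_on f S" and "v \<notin> f ` S" "w \<notin> f ` S" "reaches S f v j" "reaches S f w j"
  shows "v = w"
proof -
  have *: "v = w"
    if "(f ^^ p) v = (f ^^ q) w" "\<forall>i<p. (f ^^ i) v \<in> S" "\<forall>i<q. (f ^^ i) w \<in> S" for p q
    using that
  proof (induction p arbitrary: q)
    case 0
    show ?case
    proof (cases q)
      case (Suc r)
      then have "v = f ((f ^^ r) w)" "(f ^^ r) w \<in> S" using 0 by auto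
      then show ?thesis using assms(2) by blast
    qed (use 0 in auto)
  next
    case (Suc p)
    show ?case
    proof (cases q)
      case 0
      then have "w = f ((f ^^ p) v)" "(f ^^ p) v \<in> S" using Suc.prems by auto
      then show ?thesis using assms(3) by blast
    next
      case (Suc r)
      note q = this
      have S: "(f ^^ p) v \<in> S" "(f ^^ r) w \<in> S" using Suc.prems(2,3) q by blast+
      have "f ((f ^^ p) v) = f ((f ^^ r) w)" using Suc.prems(1) q by simp
      then have "(f ^^ p) v = (f ^^ r) w" using inj_onD[OF inj] S by blast
      moreover have "\<forall>i<p. (f ^^ i) v \<in> S" "\<forall>i<r. (f ^^ i) w \<in> S"
        using Suc.prems(2,3) q by (meson less_SucI)+
      ultimately show ?thesis by (rule Suc.IH)
    qed
  qed
  from assms(4,5) show ?thesis unfolding reaches_def using * by metis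
qed

text \<open>Walking backwards from \<open>j\<close> never repeats a point, because \<open>j\<close> has no successor; so the
  walk stops, within \<open>card S\<close> steps, at a point without predecessor.\<close>

lemma reaches_exists:
  assumes "finite S" "j \<notin> S" "S \<subseteq> N" "j \<in> N"
  shows "\<exists>v \<in> N - f ` S. reaches S f v j"
proof (rule ccontr)
  assume neg: "\<not> ?thesis"
  have walk: "\<exists>v\<in>N. (f ^^ k) v = j \<and> (\<forall>i<k. (f ^^ i) v \<in> S)" for k
  proof (induction k)
    case (Suc k)
    then obtain v where v: "v \<in> N" "(f ^^ k) v = j" "\<forall>i<k. (f ^^ i) v \<in> S" by blast
    then have "v \<in> f ` S" using neg unfolding reaches_def by blast
    then obtain u where u: "u \<in> S" "v = f u" by blast
    have "(f ^^ i) u \<in> S" if "i < Suc k" for i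
      using that u v(3) by (cases i) (auto simp: funpow_swap1)
    moreover have "(f ^^ Suc k) u = j" using u v by (simp add: funpow_swap1)
    ultimately show ?case using u assms(3) by blast
  qed (use assms in auto)
  obtain v where v: "(f ^^ Suc (card S)) v = j" "\<forall>i<Suc (card S). (f ^^ i) v \<in> S"
    using walk by blast
  have no_repeat: "(f ^^ a) v \<noteq> (f ^^ b) v" if "a < b" "b < Suc (card S)" for a b
  proof
    assume eq: "(f ^^ a) v = (f ^^ b) v"
    \<comment> \<open>Advance both equal points until the later one arrives at \<open>j\<close>. The
      earlier one is then also at \<open>j\<close>, but at an index where the walk is still in
      \<open>S\<close>.\<close>
    have "(f ^^ (Suc (card S) - b + a)) v = (f ^^ (Suc (card S) - b + b)) v"
      unfolding funpow_add comp_apply eq ..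
    also have "\<dots> = j" using v that by (simp del: funpow.simps)
    finally have "j = (f ^^ (Suc (card S) - b + a)) v" by simp
    moreover have "Suc (card S) - b + a < Suc (card S)" using that by simp
    ultimately show False using v assms(2) by blast
  qed
  have "inj_on (\<lambda>i. (f ^^ i) v) {..<Suc (card S)}"
    by (intro inj_onI) (metis lessThan_iff nat_neq_iff no_repeat)
  moreover have "(\<lambda>i. (f ^^ i) v) ` {..<Suc (card S)} \<subseteq> S" using v by auto
  ultimately have "card {..<Suc (card S)} \<le> card S"
    using assms(1) by (rule card_inj_on_le)
  then show False by simp
qed

section \<open>Summing over extensions of an injective map\<close>

text \<open>By \<open>reaches_exists\<close> and \<open>reaches_unique\<close>, a single value
  \<open>w\<close> closes a cycle and contributes an extra factor \<open>z\<close>; all other values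
  leave the number of cycles unchanged.\<close>

lemma sum_one_step_extensions:
  fixes z :: "'a::comm_ring_1"
  assumes "finite N" "S \<subseteq> N" "j \<in> N" "j \<notin> S" "f \<in> inj_maps S N"
  shows "(\<Sum>v \<in> N - f ` S. z ^ card (cycles (insert j S) (f(j := v)))) =
    z ^ card (cycles S f) * (of_nat (card N) - of_nat (card S) - 1 + z)"
proof -
  have fin: "finite S" using assms finite_subset by blast
  have inj: "inj_on f S" and im: "f ` S \<subseteq> N" using assms(5) by (auto simp: inj_maps_def)
  obtain w where w: "w \<in> N - f ` S" "reaches S f w j"
    using reaches_exists[OF fin assms(4,2,3)] by blast
  have uniq: "reaches S f v j \<longleftrightarrow> v = w" if "v \<in> N - f ` S" for v
    using reaches_unique[OF inj] that w by blast
  let ?V = "N - f ` S"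
  have "card ?V = card N - card S"
    using card_Diff_subset[OF _ im] fin card_image[OF inj] by simp
  \<comment> \<open>Strictness comes from \<open>j\<close>, and it makes the subtractions on natural
    numbers agree with those in the ring.\<close>
  moreover have "card S < card N"
    using assms by (intro psubset_card_mono) auto
  ultimately have card: "of_nat (card (?V - {w})) = (of_nat (card N) - of_nat (card S) - 1 :: 'a)"
    using w by (simp add: of_nat_diff)
  have "(\<Sum>v \<in> ?V. z ^ card (cycles (insert j S) (f(j := v)))) =
      (\<Sum>v \<in> ?V. z ^ card (cycles S f) * (if v = w then z else 1))"
    by (rule sum.cong) (auto simp: card_cycles_insert[OF fin assms(4)] uniq)
  also have "\<dots> = z ^ card (cycles S f) * (z + of_nat (card (?V - {w})))"
    using w assms(1) by (simp add: sum_distrib_left[symmetric] sum.remove[of ?V w])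
  finally show ?thesis unfolding card by (simp add: algebra_simps)
qed

lemma bij_betw_inj_maps_insert:
  assumes "j \<notin> S"
  shows "bij_betw (\<lambda>(f, v). f(j := v)) (SIGMA f : inj_maps S N. N - f ` S)
    (inj_maps (insert j S) N)"
\<comment> \<open>Maps in \<open>inj_maps S N\<close> are extensional, so restricting to
  \<open>S\<close> means resetting the value at \<open>j\<close> to
  \<open>undefined\<close>.\<close>
proof (rule bij_betwI[where g = "\<lambda>f. (f(j := undefined), f j)"])
  show "(\<lambda>(f, v). f(j := v)) \<in> (SIGMA f : inj_maps S N. N - f ` S) \<rightarrow> inj_maps (insert j S) N"
  proof
    fix p assume "p \<in> (SIGMA f : inj_maps S N. N - f ` S)"
    then obtain f v where p: "p = (f, v)" and f: "f \<in> S \<rightarrow>\<^sub>E N" "inj_on f S"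
      and v: "v \<in> N" "v \<notin> f ` S"
      unfolding inj_maps_def by blast
    have "inj_on (f(j := v)) (insert j S)"
      using inj_on_fun_updI[OF f(2) v(2), of j] v(2) assms
      by (auto simp: inj_on_insert fun_upd_image)
    moreover have "f(j := v) \<in> insert j S \<rightarrow>\<^sub>E N" using v(1) f(1) by (rule PiE_fun_upd)
    ultimately show "(\<lambda>(f, v). f(j := v)) p \<in> inj_maps (insert j S) N"
      unfolding p inj_maps_def by simp
  qed
  show "(\<lambda>f. (f(j := undefined), f j)) \<in>
      inj_maps (insert j S) N \<rightarrow> (SIGMA f : inj_maps S N. N - f ` S)"
  proof
    fix f assume "f \<in> inj_maps (insert j S) N"
    then have f: "f \<in> insert j S \<rightarrow>\<^sub>E N" "inj_on f (insert j S)" by (auto simp: inj_maps_def)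
    have eq: "(f(j := undefined)) x = f x" if "x \<in> S" for x using that assms by auto
    have im: "f(j := undefined) ` S = f ` S" using eq by (rule image_cong[OF refl])
    have "f(j := undefined) \<in> S \<rightarrow>\<^sub>E N" using assms f(1) by (rule fun_upd_in_PiE)
    moreover have "inj_on (f(j := undefined)) S"
      using f(2) by (intro inj_onI) (auto simp: eq simp del: fun_upd_apply dest: inj_onD)
    moreover have "f j \<in> N" using f(1) by auto
    moreover have "f j \<notin> f ` S" using f(2) assms by (simp add: inj_on_insert)
    ultimately show "(f(j := undefined), f j) \<in> (SIGMA f : inj_maps S N. N - f ` S)"
      using im by (simp add: inj_maps_def)
  qed
next
  fix p assume "p \<in> (SIGMA f : inj_maps S N. N - f ` S)"
  then obtain f v where p: "p = (f, v)" "f \<in> S \<rightarrow>\<^sub>E N"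
    unfolding inj_maps_def by blast
  then have "f j = undefined" using assms by (blast intro: PiE_arb)
  then show "(\<lambda>f. (f(j := undefined), f j)) ((\<lambda>(f, v). f(j := v)) p) = p"
    unfolding p by (simp add: fun_upd_idem)
qed simp

lemma finite_inj_maps: "finite S \<Longrightarrow> finite N \<Longrightarrow> finite (inj_maps S N)"
  unfolding inj_maps_def by (rule finite_subset[of _ "S \<rightarrow>\<^sub>E N"]) (auto intro: finite_PiE)

text \<open>The points of \<open>D\<close> are added one at a time. The product over
  \<open>T\<close> ignores the values on \<open>D\<close>, so each step only contributes the factor
  from \<open>sum_one_step_extensions\<close>.\<close>

lemma sum_extensions:
  fixes z :: "'a::comm_ring_1" and a :: "nat \<Rightarrow> nat \<Rightarrow> 'a"
  assumes "finite N" "T \<subseteq> N" "finite D" "D \<subseteq> N" "T \<inter> D = {}"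
  shows "(\<Sum>f \<in> inj_maps (T \<union> D) N. z ^ card (cycles (T \<union> D) f) * (\<Prod>i\<in>T. a i (f i))) =
    (\<Sum>f \<in> inj_maps T N. z ^ card (cycles T f) * (\<Prod>i\<in>T. a i (f i))) *
      pochhammer (of_nat (card N) - of_nat (card (T \<union> D)) + z) (card D)"
  using assms(3-5)
proof (induction D)
  case (insert j D)
  let ?S = "T \<union> D"
  have finT: "finite T" using assms finite_subset by blast
  have S: "?S \<subseteq> N" "j \<notin> ?S" "j \<in> N" "finite ?S" using insert assms finT by auto
  let ?h = "\<lambda>f. \<Prod>i\<in>T. a i (f i)"
  have h: "?h (f(j := v)) = ?h f" for f v using insert.prems by (intro prod.cong) auto
  have "(\<Sum>f \<in> inj_maps (insert j ?S) N. z ^ card (cycles (insert j ?S) f) * ?h f) =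
      (\<Sum>(f, v) \<in> (SIGMA f : inj_maps ?S N. N - f ` ?S).
        z ^ card (cycles (insert j ?S) (f(j := v))) * ?h (f(j := v)))"
    by (subst sum.reindex_bij_betw[OF bij_betw_inj_maps_insert[OF S(2)], symmetric])
      (simp add: case_prod_unfold)
  also have "\<dots> = (\<Sum>f \<in> inj_maps ?S N. \<Sum>v \<in> N - f ` ?S.
        z ^ card (cycles (insert j ?S) (f(j := v))) * ?h f)"
    unfolding h using assms(1) S by (subst sum.Sigma) (auto simp: finite_inj_maps)
  also have "\<dots> = (\<Sum>f \<in> inj_maps ?S N. z ^ card (cycles ?S f) * ?h f *
      (of_nat (card N) - of_nat (card ?S) - 1 + z))"
  proof (rule sum.cong)
    fix f assume "f \<in> inj_maps ?S N"
    then show "(\<Sum>v \<in> N - f ` ?S. z ^ card (cycles (insert j ?S) (f(j := v))) * ?h f) =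
        z ^ card (cycles ?S f) * ?h f * (of_nat (card N) - of_nat (card ?S) - 1 + z)"
      unfolding sum_distrib_right[symmetric]
      by (simp only: sum_one_step_extensions[OF assms(1) S(1,3,2)] mult_ac)
  qed simp
  also have "\<dots> = (\<Sum>f \<in> inj_maps ?S N. z ^ card (cycles ?S f) * ?h f) *
      (of_nat (card N) - of_nat (card ?S) - 1 + z)"
    by (simp only: sum_distrib_right)
  \<comment> \<open>The base of the rising factorial drops by one with each added point, so the new
    factor enters at its front, as in \<open>pochhammer_rec\<close>.\<close>
  also have "\<dots> = (\<Sum>f \<in> inj_maps T N. z ^ card (cycles T f) * ?h f) *
      pochhammer (of_nat (card N) - of_nat (card (insert j ?S)) + z) (Suc (card D))"
    using insert S by (simp add: pochhammer_rec algebra_simps)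
  finally show ?case using insert by simp
qed simp

section \<open>Expanding the product over the complement\<close>

text \<open>Removing \<open>T\<close> leaves an arbitrary subset of \<open>M - T\<close> of size
  \<open>l - card T\<close>; the bound \<open>card T \<le> l\<close> keeps this subtraction from
  truncating.\<close>

lemma card_supersets:
  assumes "finite M" "T \<subseteq> M" "card T \<le> l"
  shows "card {S. T \<subseteq> S \<and> S \<subseteq> M \<and> card S = l} = (card M - card T) choose (l - card T)"
proof -
  have fin: "finite T" using assms finite_subset by blast
  have "bij_betw (\<lambda>S. S - T) {S. T \<subseteq> S \<and> S \<subseteq> M \<and> card S = l}
      {D. D \<subseteq> M - T \<and> card D = l - card T}"
  proof (rule bij_betwI[where g = "\<lambda>D. T \<union> D"])
    show "(\<union>) T \<in> {D. D \<subseteq> M - T \<and> card D = l - card T} \<rightarrow>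
        {S. T \<subseteq> S \<and> S \<subseteq> M \<and> card S = l}"
    proof
      fix D assume D: "D \<in> {D. D \<subseteq> M - T \<and> card D = l - card T}"
      then have "finite D" using assms(1) by (auto intro: finite_subset)
      moreover have "T \<inter> D = {}" using D by auto
      ultimately have "card (T \<union> D) = card T + card D" using fin by (simp add: card_Un_disjoint)
      then show "T \<union> D \<in> {S. T \<subseteq> S \<and> S \<subseteq> M \<and> card S = l}" using D assms by auto
    qed
  qed (auto simp: card_Diff_subset fin)
  then show ?thesis
    using n_subsets[of "M - T" "l - card T"] assms fin
    by (simp add: bij_betw_same_card card_Diff_subset)
qed

lemma prod_diff_expand:
  fixes f :: "'b \<Rightarrow> 'a::comm_ring_1"
  assumes "finite S"
  shows "(\<Prod>i\<in>S. y - f i) = (\<Sum>T\<in>Pow S. (- 1) ^ card T * (\<Prod>i\<in>T. f i) * y ^ (card S - card T))"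
proof -
  have "(\<Prod>i\<in>S. y - f i) = (\<Prod>i\<in>S. (- f i) + y)" by simp
  also have "\<dots> = (\<Sum>T\<in>Pow S. (\<Prod>i\<in>T. - f i) * (\<Prod>i\<in>S - T. y))"
    by (rule prod_add[OF assms])
  also have "\<dots> = (\<Sum>T\<in>Pow S. (- 1) ^ card T * (\<Prod>i\<in>T. f i) * y ^ (card S - card T))"
    using assms by (intro sum.cong)
      (auto simp: prod_uminus card_Diff_subset finite_subset)
  finally show ?thesis .
qed

text \<open>After the expansion, the contribution of a pair \<open>T \<subseteq> S\<close> depends
  on \<open>T\<close> alone. Exchanging the sums therefore counts the sets \<open>S\<close> above
  \<open>T\<close>, which yields the binomial coefficient.\<close>

lemma cyclic_rook_number_complement:
  fixes A :: "'a::comm_ring_1 mat" and y z :: 'a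
  assumes A: "A \<in> carrier_mat m n" and "m \<le> n"
  shows "cyclic_rook_number l z (y \<cdot>\<^sub>m all_ones_mat m n - A) =
    (\<Sum>s=0..l. (-1) ^ s * of_nat ((m - s) choose (l - s)) * cyclic_rook_number s z A *
       pochhammer (of_nat n - of_nat l + z) (l - s) * y ^ (l - s))"
proof -
  let ?N = "{..<n}" and ?M = "{..<m}"
  define \<S> where "\<S> l = {S. S \<subseteq> ?M \<and> card S = l}" for l
  define \<T> where "\<T> = {T. T \<subseteq> ?M \<and> card T \<le> l}"
  \<comment> \<open>Cycles are counted on all of \<open>S\<close>, but entries are taken only from
    rows in \<open>T\<close>. The diagonal values \<open>W T T\<close> add up to the rook numbers of
    \<open>A\<close>.\<close>
  define W where
    "W S T = (\<Sum>f\<in>inj_maps S ?N. z ^ card (cycles S f) * (\<Prod>i\<in>T. A $$ (i, f i)))" for S T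
  have fin: "finite S" "S \<subseteq> ?N" "finite (inj_maps S ?N)" if "S \<subseteq> ?M" for S
    using that \<open>m \<le> n\<close> finite_subset[OF that] by (auto intro!: finite_inj_maps)
  have fin\<T>: "finite \<T>" and fin\<S>: "finite (\<S> l)" for l
    unfolding \<T>_def \<S>_def by auto
  have r: "cyclic_rook_number s z A = (\<Sum>T\<in>\<S> s. W T T)" for s
    using A unfolding cyclic_rook_number_def W_def \<S>_def by simp
  define F where "F T = (- 1) ^ card T * W T T *
      pochhammer (of_nat n - of_nat l + z) (l - card T) * y ^ (l - card T)" for T
  have inner: "(\<Sum>f\<in>inj_maps S ?N. z ^ card (cycles S f) *
      (\<Prod>i\<in>S. (y \<cdot>\<^sub>m all_ones_mat m n - A) $$ (i, f i))) = (\<Sum>T\<in>Pow S. F T)"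
    if S: "S \<in> \<S> l" for S
  proof -
    have SM: "S \<subseteq> ?M" and cS: "card S = l" using S by (auto simp: \<S>_def)
    have "(\<Sum>f\<in>inj_maps S ?N. z ^ card (cycles S f) *
        (\<Prod>i\<in>S. (y \<cdot>\<^sub>m all_ones_mat m n - A) $$ (i, f i))) =
      (\<Sum>f\<in>inj_maps S ?N. z ^ card (cycles S f) * (\<Prod>i\<in>S. y - A $$ (i, f i)))"
    proof (intro sum.cong refl arg_cong2[where f = "(*)"] prod.cong)
      fix f i assume "f \<in> inj_maps S ?N" "i \<in> S"
      then have "i < m" "f i < n" using SM by (auto simp: inj_maps_def)
      then show "(y \<cdot>\<^sub>m all_ones_mat m n - A) $$ (i, f i) = y - A $$ (i, f i)"
        using A by (simp add: all_ones_mat_def)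
    qed
    also have "\<dots> = (\<Sum>T\<in>Pow S. (- 1) ^ card T * W S T * y ^ (l - card T))"
      unfolding prod_diff_expand[OF fin(1)[OF SM]] sum_distrib_left W_def cS
      by (subst sum.swap) (simp add: sum_distrib_left sum_distrib_right mult_ac)
    also have "\<dots> = (\<Sum>T\<in>Pow S. F T)"
    proof (rule sum.cong)
      fix T assume "T \<in> Pow S"
      then have T: "T \<subseteq> S" "T \<subseteq> ?N" "finite T" "S - T \<subseteq> ?N" and D: "T \<union> (S - T) = S"
        using fin[OF SM] finite_subset by auto
      have "W S T = W T T * pochhammer (of_nat n - of_nat l + z) (l - card T)"
        using sum_extensions[of ?N T "S - T" z "\<lambda>i j. A $$ (i, j)"] T fin(1,2)[OF SM]
        unfolding D by (simp add: W_def cS card_Diff_subset)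
      then show "(- 1) ^ card T * W S T * y ^ (l - card T) = F T" by (simp add: F_def mult_ac)
    qed simp
    finally show ?thesis .
  qed
  have "cyclic_rook_number l z (y \<cdot>\<^sub>m all_ones_mat m n - A) = (\<Sum>S\<in>\<S> l. \<Sum>T\<in>Pow S. F T)"
    using A inner by (simp add: cyclic_rook_number_def \<S>_def)
  \<comment> \<open>Drawing \<open>T\<close> from a family independent of \<open>S\<close> puts the
    double sum into the form that \<open>sum.swap_restrict\<close> exchanges.\<close>
  also have "\<dots> = (\<Sum>S\<in>\<S> l. \<Sum>T\<in>{T \<in> \<T>. T \<subseteq> S}. F T)"
  proof (intro sum.cong refl)
    fix S assume S: "S \<in> \<S> l"
    then show "Pow S = {T \<in> \<T>. T \<subseteq> S}"
      using fin(1)[of S] card_mono[of S] by (auto simp: \<S>_def \<T>_def)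
  qed
  also have "\<dots> = (\<Sum>T\<in>\<T>. \<Sum>S\<in>{S \<in> \<S> l. T \<subseteq> S}. F T)"
    by (rule sum.swap_restrict[OF fin\<S> fin\<T>])
  also have "\<dots> = (\<Sum>T\<in>\<T>. of_nat ((m - card T) choose (l - card T)) * F T)"
  proof (rule sum.cong)
    fix T assume "T \<in> \<T>"
    then have "card {S \<in> \<S> l. T \<subseteq> S} = (m - card T) choose (l - card T)"
      using card_supersets[of ?M T l] by (simp add: \<T>_def \<S>_def conj_ac)
    then show "(\<Sum>S\<in>{S \<in> \<S> l. T \<subseteq> S}. F T) = of_nat ((m - card T) choose (l - card T)) * F T"
      by simp
  qed simp
  also have "\<dots> = (\<Sum>s\<in>{0..l}. \<Sum>T\<in>{T \<in> \<T>. card T = s}.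
      of_nat ((m - card T) choose (l - card T)) * F T)"
    by (rule sum.group[symmetric, OF fin\<T>]) (auto simp: \<T>_def)
  also have "\<dots> = (\<Sum>s=0..l. (-1) ^ s * of_nat ((m - s) choose (l - s)) * cyclic_rook_number s z A *
       pochhammer (of_nat n - of_nat l + z) (l - s) * y ^ (l - s))"
  proof (rule sum.cong)
    fix s assume "s \<in> {0..l}"
    then have "{T \<in> \<T>. card T = s} = \<S> s" by (auto simp: \<T>_def \<S>_def)
    moreover have "(\<Sum>T\<in>\<S> s. of_nat ((m - card T) choose (l - card T)) * F T) =
       (\<Sum>T\<in>\<S> s. (-1) ^ s * of_nat ((m - s) choose (l - s)) * W T T *
       pochhammer (of_nat n - of_nat l + z) (l - s) * y ^ (l - s))"
      by (rule sum.cong) (auto simp: F_def \<S>_def mult_ac)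
    ultimately show "(\<Sum>T\<in>{T \<in> \<T>. card T = s}. of_nat ((m - card T) choose (l - card T)) * F T) =
      (-1) ^ s * of_nat ((m - s) choose (l - s)) * cyclic_rook_number s z A *
       pochhammer (of_nat n - of_nat l + z) (l - s) * y ^ (l - s)"
      unfolding r by (simp add: sum_distrib_left sum_distrib_right)
  qed simp
  finally show ?thesis .
qed

theorem theorem6:
  fixes A :: "'a::comm_ring_1 mat" and y z :: 'a and m n :: nat
  assumes "A \<in> carrier_mat m n" and "m \<le> n"
  shows "(\<forall>l\<le>m. cyclic_rook_number l z (y \<cdot>\<^sub>m all_ones_mat m n - A) =
            (\<Sum>s=0..l. (-1) ^ s * of_nat ((m - s) choose (l - s)) * cyclic_rook_number s z A *
               pochhammer (of_nat n - of_nat l + z) (l - s) * y ^ (l - s))) \<and>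
         cyclic_permanent z (y \<cdot>\<^sub>m all_ones_mat m n - A) =
            (\<Sum>s=0..m. (-1) ^ s * cyclic_rook_number s z A *
               pochhammer (of_nat n - of_nat m + z) (m - s) * y ^ (m - s))"
proof -
  have "dim_row (y \<cdot>\<^sub>m all_ones_mat m n - A) = m" using assms(1) by simp
  \<comment> \<open>The permanent is the case \<open>l = m\<close>, in which every binomial
    coefficient equals 1.\<close>
  then show ?thesis
    using cyclic_rook_number_complement[OF assms] by (simp add: cyclic_permanent_def)
qed

end
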